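(* For all natural numbers $n$ and $r$ with $n \ge 2r+1$, $$\sum_{i=1}^{n-2r} q^{(r+1)(n-2r-i)} \genfrac{[}{]}{0pt}{}{r-1+i}{r}_q \genfrac{[}{]}{0pt}{}{n-r-i}{r}_q = \genfrac{[}{]}{0pt}{}{n}{2r+1}_q .$$
   Context: Natural numbers here are non-negative integers, and $q$ is an indeterminate. For non-negative integers $n, k$, the Gaussian polynomial ($q$-binomial coefficient) is $$\genfrac{[}{]}{0pt}{}{n}{k}_q = \frac{(q^n-1)(q^{n-1}-1)\cdots(q^{n-k+1}-1)}{(q^k-1)(q^{k-1}-1)\cdots(q-1)},$$ with the empty product (case $k=0$) equal to $1$, so $\genfrac{[}{]}{0pt}{}{n}{0}_q=\genfrac{[}{]}{0pt}{}{n}{n}_q=1$. The identity is an identity of polynomials in $q$. *)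

theory Defs
  imports "HOL-Computational_Algebra.Polynomial"
begin

definition gauss_numer :: "nat \<Rightarrow> nat \<Rightarrow> int poly" where
  "gauss_numer n k = (\<Prod>j<k. monom 1 (n - j) - 1)"

definition gauss_denom :: "nat \<Rightarrow> int poly" where
  "gauss_denom k = (\<Prod>j<k. monom 1 (k - j) - 1)"

(* The indeterminate q is "monom 1 1", so q ^ m is "monom 1 m". The quotient is a
   polynomial division; it is exact by gauss_poly_exact below, so gauss_poly n k is the
   value of the quotient of rational functions. For k > n the truncated
   difference n - j does no harm: the factor j = n makes the numerator 0. *)
definition gauss_poly :: "nat \<Rightarrow> nat \<Rightarrow> int poly" where
  "gauss_poly n k = gauss_numer n k div gauss_denom k"

lemma gauss_numer_Suc: "gauss_numer n (Suc k) = gauss_numer n k * (monom 1 (n - k) - 1)"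
  by (simp add: gauss_numer_def)

lemma gauss_numer_Suc_Suc:
  "gauss_numer (Suc n) (Suc k) = (monom 1 (Suc n) - 1) * gauss_numer n k"
  unfolding gauss_numer_def by (subst prod.lessThan_Suc_shift) simp

lemma gauss_denom_Suc: "gauss_denom (Suc k) = (monom 1 (Suc k) - 1) * gauss_denom k"
  unfolding gauss_denom_def by (subst prod.lessThan_Suc_shift) simp

lemma gauss_numer_eq_0:
  assumes "n < k"
  shows "gauss_numer n k = 0"
  using assms unfolding gauss_numer_def by (auto intro!: bexI[of _ n])

lemma gauss_denom_nonzero: "gauss_denom k \<noteq> 0"
proof -
  have "monom (1::int) (k - j) - 1 \<noteq> 0" if "j < k" for j
  proof
    assume "monom (1::int) (k - j) - 1 = 0"
    then have "coeff (monom (1::int) (k - j)) (k - j) = coeff 1 (k - j)" by simp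
    with that show False by simp
  qed
  then show ?thesis by (simp add: gauss_denom_def)
qed

lemma gauss_denom_dvd: "gauss_denom k dvd gauss_numer n k"
proof (induction n arbitrary: k)
  case 0
  show ?case
    by (cases k) (simp_all add: gauss_numer_eq_0, simp add: gauss_numer_def gauss_denom_def)
next
  case (Suc n)
  show ?case
  proof (cases k)
    case 0
    then show ?thesis by (simp add: gauss_numer_def gauss_denom_def)
  next
    case (Suc m)
    have "gauss_numer (Suc n) (Suc m) =
      monom 1 (n - m) * ((monom 1 (Suc m) - 1) * gauss_numer n m) + gauss_numer n (Suc m)"
    proof (cases "m \<le> n")
      case True
      then have "monom (1::int) (Suc n) = monom 1 (n - m) * monom 1 (Suc m)"
        by (simp add: mult_monom)
      then show ?thesis
        unfolding gauss_numer_Suc_Suc unfolding gauss_numer_Suc by (simp add: algebra_simps)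
    next
      case False
      then show ?thesis by (simp add: gauss_numer_eq_0)
    qed
    moreover have "gauss_denom (Suc m) dvd (monom 1 (Suc m) - 1) * gauss_numer n m"
      unfolding gauss_denom_Suc using Suc.IH by (rule mult_dvd_mono[OF dvd_refl])
    ultimately show ?thesis using Suc Suc.IH[of "Suc m"] by simp
  qed
qed

lemma gauss_poly_exact: "gauss_poly n k * gauss_denom k = gauss_numer n k"
  using gauss_denom_dvd unfolding gauss_poly_def by (rule dvd_div_mult_self)

end

theory Submission
  imports Defs
begin

text \<open>
  The identity is a special case of the \<open>q\<close>-Vandermonde convolution
  \[ \sum_{s \le M} q^{(b+1)s} {a+s \brack a} {b+M-s \brack b} = {a+b+M+1 \brack a+b+1}, \]
  namely \<open>a = b = r\<close>, \<open>M = n - 2r - 1\<close> and \<open>s = n - 2r - i\<close>.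

  Combinatorially, the Gaussian polynomial \<open>{n \brack k}\<close> counts the \<open>k\<close>-subsets of an
  \<open>n\<close>-element chain, weighted by \<open>q\<close> to the number of pairs of an unchosen element
  below a chosen one. Sort the subsets of size \<open>a + b + 1\<close> by their \<open>(a+1)\<close>-st
  smallest element, the pivot. If \<open>s\<close> unchosen elements lie below the pivot, then there are
  \<open>a + s\<close> elements below it, \<open>a\<close> of them chosen, and \<open>b + M - s\<close> above it, \<open>b\<close> of them
  chosen. The pivot and the \<open>b\<close> chosen elements above it each pair with those \<open>s\<close> unchosen
  elements, which gives the factor \<open>q^{(b+1)s}\<close>.

  The algebraic proof rests on the Pascal rule \<open>gauss_poly_Suc_Suc\<close>. Applied to the
  factor \<open>{a+s \brack a}\<close>, it shows that the convolution satisfies in \<open>(a, M)\<close> the same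
  recurrence as the right-hand side (\<open>gauss_poly_convolution\<close>).
\<close>

lemma gauss_poly_0_right [simp]: "gauss_poly n 0 = 1"
  by (simp add: gauss_poly_def gauss_numer_def gauss_denom_def)

lemma gauss_poly_self [simp]: "gauss_poly n n = 1"
proof -
  have "gauss_numer n n = gauss_denom n"
    by (simp add: gauss_numer_def gauss_denom_def)
  then show ?thesis
    by (simp add: gauss_poly_def gauss_denom_nonzero)
qed

text \<open>
  After multiplication by the denominator for \<open>k + 1\<close>, the rule becomes
  \<open>q^(n+1) - 1 = (q^(k+1) - 1) + q^(k+1) (q^(n-k) - 1)\<close> times the common numerator for \<open>(n, k)\<close>.
\<close>

lemma gauss_poly_Suc_Suc:
  "gauss_poly (Suc n) (Suc k) = gauss_poly n k + monom 1 (Suc k) * gauss_poly n (Suc k)"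
proof -
  let ?N = "gauss_numer n k"
  have "(gauss_poly n k + monom 1 (Suc k) * gauss_poly n (Suc k)) * gauss_denom (Suc k)
      = (monom 1 (Suc k) - 1) * (gauss_poly n k * gauss_denom k)
        + monom 1 (Suc k) * (gauss_poly n (Suc k) * gauss_denom (Suc k))"
    by (simp add: gauss_denom_Suc algebra_simps)
  also have "\<dots> = (monom 1 (Suc k) - 1) * ?N + monom 1 (Suc k) * (?N * (monom 1 (n - k) - 1))"
    by (simp only: gauss_poly_exact gauss_numer_Suc)
  also have "\<dots> = (monom 1 (Suc n) - 1) * ?N"
  proof (cases "k \<le> n")
    case True
    then have "monom (1::int) (Suc n) = monom 1 (Suc k) * monom 1 (n - k)"
      by (simp add: mult_monom)
    then show ?thesis
      by (simp add: algebra_simps)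
  next
    case False
    \<comment> \<open>The exponents no longer add up, since \<open>n - k\<close> is truncated, but the numerator vanishes.\<close>
    then show ?thesis
      by (simp add: gauss_numer_eq_0)
  qed
  also have "\<dots> = gauss_poly (Suc n) (Suc k) * gauss_denom (Suc k)"
    by (simp only: gauss_poly_exact gauss_numer_Suc_Suc)
  finally show ?thesis
    using gauss_denom_nonzero by simp
qed

text \<open>
  Both sides, as functions of \<open>a\<close> and \<open>M\<close>, satisfy
  \<open>F (a+1) (M+1) = F a (M+1) + q^(a+b+2) F (a+1) M\<close>. On the left, the Pascal rule puts
  \<open>q^(a+1)\<close> in front of its second term, and lowering \<open>s\<close> by one releases another \<open>q^(b+1)\<close>. On the
  boundary, both sides are \<open>1\<close> for \<open>M = 0\<close>, and for \<open>a = 0\<close> the first term of the recurrence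
  is replaced by \<open>gauss_poly (b + M + 1) b\<close>, the summand for \<open>s = 0\<close>.
\<close>

lemma gauss_poly_convolution:
  "(\<Sum>s\<le>M. monom 1 (Suc b * s) * gauss_poly (a + s) a * gauss_poly (b + (M - s)) b)
    = gauss_poly (a + b + M + 1) (a + b + 1)"
proof (induction M arbitrary: a)
  case 0
  show ?case by simp
next
  case (Suc M)
  note IH_M = Suc.IH
  define T where "T a s = monom 1 (Suc b * s) * gauss_poly (a + s) a * gauss_poly (b + (M - s)) b"
    for a s
  have T_sum: "(\<Sum>s\<le>M. T a s) = gauss_poly (a + b + M + 1) (a + b + 1)" for a
    unfolding T_def by (rule IH_M)
  let ?f = "\<lambda>a s. monom 1 (Suc b * s) * gauss_poly (a + s) a * gauss_poly (b + (Suc M - s)) b"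
  show ?case
  proof (induction a)
    case 0
    have "?f 0 (Suc s) = monom 1 (b + 1) * T 0 s" for s
      by (simp add: T_def mult_monom flip: mult.assoc)
    moreover have "?f 0 0 = gauss_poly (b + Suc M) b"
      by simp
    ultimately have "(\<Sum>s\<le>Suc M. ?f 0 s)
        = gauss_poly (b + Suc M) b + monom 1 (b + 1) * (\<Sum>s\<le>M. T 0 s)"
      unfolding sum.atMost_Suc_shift by (simp only: sum_distrib_left)
    also have "\<dots> = gauss_poly (0 + b + Suc M + 1) (0 + b + 1)"
      by (simp add: T_sum gauss_poly_Suc_Suc)
    finally show ?case .
  next
    case (Suc a)
    have "?f (Suc a) (Suc s) = ?f a (Suc s) + monom 1 (a + b + 2) * T (Suc a) s" for s
    proof -
      have "monom (1::int) (Suc b * Suc s) * monom 1 (Suc a)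
          = monom 1 (a + b + 2) * monom 1 (Suc b * s)"
        by (simp add: mult_monom algebra_simps)
      moreover have "gauss_poly (Suc a + Suc s) (Suc a)
          = gauss_poly (a + Suc s) a + monom 1 (Suc a) * gauss_poly (Suc a + s) (Suc a)"
        by (simp add: gauss_poly_Suc_Suc)
      ultimately show ?thesis
        unfolding T_def by (simp only: distrib_left distrib_right diff_Suc_Suc flip: mult.assoc)
    qed
    moreover have "?f (Suc a) 0 = ?f a 0"
      by simp
    ultimately have "(\<Sum>s\<le>Suc M. ?f (Suc a) s)
        = (\<Sum>s\<le>Suc M. ?f a s) + monom 1 (a + b + 2) * (\<Sum>s\<le>M. T (Suc a) s)"
      unfolding sum.atMost_Suc_shift by (simp only: sum.distrib sum_distrib_left add.assoc)
    also have "\<dots> = gauss_poly (Suc a + b + Suc M + 1) (Suc a + b + 1)"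
      unfolding Suc.IH T_sum by (simp add: gauss_poly_Suc_Suc)
    finally show ?case .
  qed
qed

theorem theorem3:
  fixes n r :: nat
  assumes "n \<ge> 2 * r + 1"
  shows "(\<Sum>i = 1..n - 2 * r.
            monom 1 ((r + 1) * (n - 2 * r - i)) * gauss_poly (r + i - 1) r * gauss_poly (n - r - i) r)
         = gauss_poly n (2 * r + 1)"
proof -
  obtain M where n: "n = 2 * r + 1 + M"
    using assms le_Suc_ex by blast
  have "(\<Sum>i = 1..n - 2 * r.
            monom 1 ((r + 1) * (n - 2 * r - i)) * gauss_poly (r + i - 1) r * gauss_poly (n - r - i) r)
      = (\<Sum>s\<le>M. monom 1 (Suc r * s) * gauss_poly (r + s) r * gauss_poly (r + (M - s)) r)"
  proof (rule sum.reindex_bij_witness[where i = "\<lambda>s. Suc M - s" and j = "\<lambda>i. Suc M - i"], goal_cases)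
    case (5 i)
    then have "n - 2 * r - i = Suc M - i" "r + i - 1 = r + (M - (Suc M - i))"
      "n - r - i = r + (Suc M - i)"
      using n by auto
    then show ?case
      by (simp add: mult_ac)
  qed (use n in auto)
  also have "\<dots> = gauss_poly n (2 * r + 1)"
    unfolding gauss_poly_convolution n by (simp add: mult_2 add_ac)
  finally show ?thesis .
qed

end
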